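(* Let $X_1,\dots,X_n$ be a set of exchangeable real random variables, and let $U$ be a uniform random variable on $[0,1]$ that is independent of $X_1,\dots,X_n$. Then for any $a\in(0,1)$, $$P\left(X_1\ge U/a\ \text{ or }\ \exists\, t\le n:\ \left|\frac1t\sum_{i=1}^tX_i\right|\ge 1/a\right)\le a\,\mathbb E|X_1|,$$ where $t$ ranges over $\{1,\dots,n\}$.
   Context: $X_1,\dots,X_n$ are exchangeable if the joint distribution of $(X_1,\dots,X_n)$ equals that of $(X_{\pi(1)},\dots,X_{\pi(n)})$ for every permutation $\pi$ of $\{1,\dots,n\}$. If $X_1$ is not integrable the right-hand side is $+\infty$. *)

theory Defs
  imports "HOL-Probability.Probability" "HOL-Combinatorics.Permutations"
begin

text \<open>The joint distribution of \<open>X\<^sub>1, \<dots>, X\<^sub>n\<close> is a measure on the product space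
  \<open>PiM {1..n} (\<lambda>_. borel)\<close>, whose elements are the functions on \<open>{1..n}\<close> that are
  \<open>undefined\<close> elsewhere; hence the restriction in the random vector.\<close>

definition rvec :: "nat \<Rightarrow> (nat \<Rightarrow> 'a \<Rightarrow> real) \<Rightarrow> 'a \<Rightarrow> nat \<Rightarrow> real" where
  "rvec n X = (\<lambda>\<omega>. \<lambda>i\<in>{1..n}. X i \<omega>)"

definition exchangeable :: "'a measure \<Rightarrow> nat \<Rightarrow> (nat \<Rightarrow> 'a \<Rightarrow> real) \<Rightarrow> bool" where
  "exchangeable M n X \<longleftrightarrow>
     (\<forall>i\<in>{1..n}. X i \<in> borel_measurable M) \<and>
     (\<forall>\<pi>. \<pi> permutes {1..n} \<longrightarrow>
        distr M (PiM {1..n} (\<lambda>_. borel)) (rvec n (\<lambda>i. X (\<pi> i))) =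
        distr M (PiM {1..n} (\<lambda>_. borel)) (rvec n X))"

text \<open>Independence of \<open>U\<close> from \<open>X\<^sub>1, \<dots>, X\<^sub>n\<close> jointly: the generated
  \<open>\<sigma>\<close>-algebras are independent.  The library's \<open>indep_var\<close> is not applicable, as it
  requires both random variables to take values in the same type.\<close>

definition indep_rvec :: "'a measure \<Rightarrow> ('a \<Rightarrow> real) \<Rightarrow> nat \<Rightarrow> (nat \<Rightarrow> 'a \<Rightarrow> real) \<Rightarrow> bool" where
  "indep_rvec M U n X \<longleftrightarrow>
     prob_space.indep_set M
       (sets (vimage_algebra (space M) U borel))
       (sets (vimage_algebra (space M) (rvec n X) (PiM {1..n} (\<lambda>_. borel))))"

end

theory Submission imports Defs begin

text \<open>Decompose according to the last time \<open>t\<close> at which the absolute average is at least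
  \<open>1 / a\<close>. The event \<open>A\<^sub>t\<close> that this time is \<open>t\<close> depends on \<open>X\<^sub>1, \<dots>, X\<^sub>t\<close> symmetrically, so
  Markov's inequality and exchangeability give \<open>P(A\<^sub>t) \<le> a E[|X\<^sub>1|; A\<^sub>t]\<close>. On the event \<open>C\<close> that
  there is no such time, independence and uniformity of \<open>U\<close> give
  \<open>P(C, U \<le> a X\<^sub>1) \<le> a E[|X\<^sub>1|; C]\<close>. Since these events partition the space, the bounds
  add up to \<open>a E|X\<^sub>1|\<close>.\<close>

section \<open>Randomised Markov bound for an independent uniform variable\<close>

text \<open>By independence the joint law is a product, so \<open>W\<close> can be frozen at
  \<open>w\<close> (Tonelli). The uniform law gives \<open>{..a * w}\<close> mass at most
  \<open>a * \<bar>w\<bar>\<close>, and integrating over the law of \<open>W\<close> yields the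
  bound.\<close>

lemma (in prob_space) indep_var_uniform_le:
  fixes U W :: "'a \<Rightarrow> real"
  assumes ind: "indep_var borel U borel W"
    and U: "distr M borel U = uniform_measure lborel {0..1}"
    and "0 \<le> a"
  shows "emeasure M {\<omega> \<in> space M. U \<omega> \<le> a * W \<omega>} \<le> ennreal a * (\<integral>\<^sup>+\<omega>. ennreal \<bar>W \<omega>\<bar> \<partial>M)"
proof -
  have [measurable]: "random_variable borel U" "random_variable borel W"
    using ind by (auto simp: indep_var_eq)
  let ?B = "{z :: real \<times> real. fst z \<le> a * snd z}"
  interpret dU: prob_space "distr M borel U" by (rule prob_space_distr) measurable
  interpret dW: prob_space "distr M borel W" by (rule prob_space_distr) measurable
  interpret p: pair_sigma_finite "distr M borel U" "distr M borel W" ..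
  have "{z \<in> space (borel \<Otimes>\<^sub>M borel). fst z \<le> a * snd z} \<in> sets (borel \<Otimes>\<^sub>M borel)"
    by measurable
  then have B: "?B \<in> sets (borel \<Otimes>\<^sub>M borel)" by (simp add: space_pair_measure)
  have slice: "emeasure (distr M borel U) {..a * w} \<le> ennreal a * ennreal \<bar>w\<bar>" for w
  proof -
    have "emeasure (distr M borel U) {..a * w} = emeasure lborel ({0..1} \<inter> {..a * w})"
      by (simp add: U emeasure_uniform_measure divide_ennreal_def)
    \<comment> \<open>The absolute value covers both signs of \<open>w\<close>: the endpoint is
      nonnegative, so the interval has length exactly \<open>a * \<bar>w\<bar>\<close>. The cut at 1
      is dropped.\<close>
    also have "\<dots> \<le> emeasure lborel {0..a * \<bar>w\<bar>}"
    proof (rule emeasure_mono)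
      have "a * w \<le> a * \<bar>w\<bar>" using \<open>0 \<le> a\<close> by (intro mult_left_mono) auto
      then show "{0..1} \<inter> {..a * w} \<subseteq> {0..a * \<bar>w\<bar>}" by auto
    qed simp
    finally show ?thesis using \<open>0 \<le> a\<close> by (simp add: ennreal_mult)
  qed
  have "emeasure M {\<omega> \<in> space M. U \<omega> \<le> a * W \<omega>} =
      emeasure (distr M (borel \<Otimes>\<^sub>M borel) (\<lambda>\<omega>. (U \<omega>, W \<omega>))) ?B"
    using B by (subst emeasure_distr) (auto intro!: arg_cong[where f = "emeasure M"])
  also have "\<dots> = emeasure (distr M borel U \<Otimes>\<^sub>M distr M borel W) ?B"
    using ind by (simp add: indep_var_distribution_eq)
  also have "\<dots> = (\<integral>\<^sup>+w. emeasure (distr M borel U) ((\<lambda>u. (u, w)) -` ?B) \<partial>distr M borel W)"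
    using B by (intro p.emeasure_pair_measure_alt2) (simp cong: sets_pair_measure_cong)
  also have "\<dots> = (\<integral>\<^sup>+w. emeasure (distr M borel U) {..a * w} \<partial>distr M borel W)"
    by (intro nn_integral_cong arg_cong[where f = "emeasure _"]) auto
  also have "\<dots> \<le> (\<integral>\<^sup>+w. ennreal a * ennreal \<bar>w\<bar> \<partial>distr M borel W)"
    by (intro nn_integral_mono slice)
  also have "\<dots> = ennreal a * (\<integral>\<^sup>+\<omega>. ennreal \<bar>W \<omega>\<bar> \<partial>M)"
    by (simp add: nn_integral_cmult nn_integral_distr)
  finally show ?thesis .
qed

text \<open>The \<sigma>-algebra generated by \<open>g (rvec n X \<omega>)\<close> lies inside the
  one generated by \<open>rvec n X\<close>, and independence passes to smaller families of events.
  Both variables are now real, as \<open>indep_var\<close> demands.\<close>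

lemma (in prob_space) indep_rvec_imp_indep_var:
  assumes U: "U \<in> borel_measurable M"
    and V: "rvec n X \<in> measurable M (PiM {1..n} (\<lambda>_. borel))"
    and ind: "indep_rvec M U n X"
    and g: "g \<in> borel_measurable (PiM {1..n} (\<lambda>_. borel))"
  shows "indep_var borel U borel (\<lambda>\<omega>. g (rvec n X \<omega>))"
proof -
  let ?P = "PiM {1..n} (\<lambda>_. borel :: real measure)"
  have gV: "(\<lambda>\<omega>. g (rvec n X \<omega>)) \<in> borel_measurable M"
    using measurable_compose[OF V g] .
  have sub: "sigma_sets (space M) {(\<lambda>\<omega>. g (rvec n X \<omega>)) -` A \<inter> space M | A. A \<in> sets borel}
      \<subseteq> sets (vimage_algebra (space M) (rvec n X) ?P)"
  proof -
    have "(\<lambda>\<omega>. g (rvec n X \<omega>)) \<in> borel_measurable (vimage_algebra (space M) (rvec n X) ?P)"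
      using g measurable_space[OF V] by (intro measurable_compose[OF measurable_vimage_algebra1]) auto
    from measurable_sets[OF this]
    have "{(\<lambda>\<omega>. g (rvec n X \<omega>)) -` A \<inter> space M | A. A \<in> sets borel}
        \<subseteq> sets (vimage_algebra (space M) (rvec n X) ?P)"
      by auto
    from sets.sigma_sets_subset[OF this] show ?thesis by simp
  qed
  have "indep_set (sigma_sets (space M) {U -` A \<inter> space M | A. A \<in> sets borel})
     (sigma_sets (space M) {(\<lambda>\<omega>. g (rvec n X \<omega>)) -` A \<inter> space M | A. A \<in> sets borel})"
    using ind sub unfolding indep_rvec_def indep_set_def sets_vimage_algebra
    by (elim indep_sets_mono_sets) (auto split: bool.split)
  then show ?thesis
    using U gV by (simp add: indep_var_eq)
qed

section \<open>Exchangeability at the level of expectations\<close>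

lemma exchangeable_rvec_measurable:
  assumes "exchangeable M n X" "\<pi> permutes {1..n}"
  shows "rvec n (\<lambda>i. X (\<pi> i)) \<in> measurable M (PiM {1..n} (\<lambda>_. borel))"
  unfolding rvec_def
  using assms permutes_in_image[OF assms(2)]
  by (intro measurable_restrict) (auto simp: exchangeable_def)

text \<open>Both integrals are integrals of \<open>g\<close> against image measures on the product
  space, and exchangeability says that these measures coincide.\<close>

lemma exchangeable_nn_integral:
  assumes ex: "exchangeable M n X" and \<pi>: "\<pi> permutes {1..n}"
    and g: "g \<in> borel_measurable (PiM {1..n} (\<lambda>_. borel))"
  shows "(\<integral>\<^sup>+\<omega>. g (rvec n (\<lambda>i. X (\<pi> i)) \<omega>) \<partial>M) = (\<integral>\<^sup>+\<omega>. g (rvec n X \<omega>) \<partial>M)"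
proof -
  let ?P = "PiM {1..n} (\<lambda>_. borel :: real measure)"
  have "(\<integral>\<^sup>+\<omega>. g (rvec n (\<lambda>i. X (\<pi> i)) \<omega>) \<partial>M) = (\<integral>\<^sup>+x. g x \<partial>distr M ?P (rvec n (\<lambda>i. X (\<pi> i))))"
    using exchangeable_rvec_measurable[OF ex \<pi>] g by (simp add: nn_integral_distr)
  also have "\<dots> = (\<integral>\<^sup>+x. g x \<partial>distr M ?P (rvec n X))"
    using ex \<pi> by (simp add: exchangeable_def)
  also have "\<dots> = (\<integral>\<^sup>+\<omega>. g (rvec n X \<omega>) \<partial>M)"
    using exchangeable_rvec_measurable[OF ex permutes_id] g by (simp add: nn_integral_distr)
  finally show ?thesis .
qed

section \<open>The last crossing time and its symmetry\<close>

text \<open>A set of vectors rather than of sample points, so that its indicator can serve as the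
  functional \<open>g\<close> to which exchangeability and independence are applied.\<close>

definition last_crossing :: "nat \<Rightarrow> real \<Rightarrow> nat \<Rightarrow> (nat \<Rightarrow> real) set" where
  "last_crossing n c t = {x \<in> space (PiM {1..n} (\<lambda>_. borel)).
     c \<le> \<bar>1 / real t * (\<Sum>i=1..t. x i)\<bar> \<and>
     (\<forall>s\<in>{t<..n}. \<bar>1 / real s * (\<Sum>i=1..s. x i)\<bar> < c)}"

lemma sets_last_crossing [measurable]:
  assumes "t \<le> n"
  shows "last_crossing n c t \<in> sets (PiM {1..n} (\<lambda>_. borel))"
proof -
  let ?P = "PiM {1..n} (\<lambda>_. borel :: real measure)"
  have avg: "(\<lambda>x. \<bar>1 / real s * (\<Sum>i=1..s. x i)\<bar>) \<in> borel_measurable ?P" if "s \<le> n" for s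
    using that
    by (intro borel_measurable_abs borel_measurable_times borel_measurable_const
        borel_measurable_sum measurable_component_singleton) auto
  have "{x \<in> space ?P. \<forall>s\<in>{t<..n}. \<bar>1 / real s * (\<Sum>i=1..s. x i)\<bar> < c} \<in> sets ?P"
    by (intro sets.sets_Collect_finite_All borel_measurable_less avg) auto
  moreover have "{x \<in> space ?P. c \<le> \<bar>1 / real t * (\<Sum>i=1..t. x i)\<bar>} \<in> sets ?P"
    using assms by (intro borel_measurable_le avg) auto
  ultimately show ?thesis
    unfolding last_crossing_def by (simp add: sets.sets_Collect_conj)
qed

lemma disjoint_family_last_crossing: "disjoint_family_on (last_crossing n c) {1..n}"
proof -
  have *: "last_crossing n c s \<inter> last_crossing n c t = {}" if "s < t" "t \<le> n" for s t
  proof -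
    have "t \<in> {s<..n}" using that by simp
    then show ?thesis unfolding last_crossing_def by (auto simp: not_le[symmetric])
  qed
  show ?thesis
    unfolding disjoint_family_on_def
  proof (intro ballI impI)
    fix s t assume "s \<in> {1..n}" "t \<in> {1..n}" "s \<noteq> t"
    then show "last_crossing n c s \<inter> last_crossing n c t = {}"
      using *[of s t] *[of t s] by (cases "s < t") (simp_all add: Int_commute)
  qed
qed

text \<open>The largest crossing index serves as witness. Hence a vector outside all the sets
  \<open>last_crossing n c t\<close> has no crossing at all.\<close>

lemma last_crossing_exists:
  assumes x: "x \<in> space (PiM {1..n} (\<lambda>_. borel))"
    and t: "t \<in> {1..n}" "c \<le> \<bar>1 / real t * (\<Sum>i=1..t. x i)\<bar>"
  shows "\<exists>t\<in>{1..n}. x \<in> last_crossing n c t"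
proof -
  let ?T = "{t \<in> {1..n}. c \<le> \<bar>1 / real t * (\<Sum>i=1..t. x i)\<bar>}"
  have fin: "finite ?T" by simp
  define m where "m = Max ?T"
  have "m \<in> ?T" unfolding m_def using t by (intro Max_in fin) auto
  moreover have "\<bar>1 / real s * (\<Sum>i=1..s. x i)\<bar> < c" if s: "s \<in> {m<..n}" for s
  proof (rule ccontr)
    assume "\<not> ?thesis"
    then have "s \<in> ?T" using s by simp
    then have "s \<le> m" unfolding m_def by (rule Max_ge[OF fin])
    with s show False by simp
  qed
  ultimately show ?thesis using x
    by (intro bexI[of _ m]) (auto simp: last_crossing_def)
qed

text \<open>Membership involves only the partial sums up to some \<open>s\<close> with
  \<open>t \<le> s\<close>, and these contain all the permuted terms. Earlier partial sums could
  change, which is why the last crossing is used and not the first.\<close>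

lemma last_crossing_permute:
  assumes \<pi>: "\<pi> permutes {1..t}" and "t \<le> n"
  shows "rvec n (\<lambda>i. X (\<pi> i)) \<omega> \<in> last_crossing n c t \<longleftrightarrow> rvec n X \<omega> \<in> last_crossing n c t"
proof -
  have "(\<Sum>i=1..s. rvec n (\<lambda>i. X (\<pi> i)) \<omega> i) = (\<Sum>i=1..s. rvec n X \<omega> i)"
    if s: "t \<le> s" "s \<le> n" for s
  proof -
    have "(\<Sum>i=1..s. rvec n (\<lambda>i. X (\<pi> i)) \<omega> i) = (\<Sum>i=1..s. X (\<pi> i) \<omega>)"
      using s by (intro sum.cong) (auto simp: rvec_def)
    also have "\<dots> = (\<Sum>i=1..s. X i \<omega>)"
      \<comment> \<open>A permutation of \<open>{1..t}\<close> fixes the indices beyond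
        \<open>t\<close>, so it also permutes \<open>{1..s}\<close>.\<close>
      using s by (intro sum.permute[OF permutes_subset[OF \<pi>], symmetric, unfolded o_def]) auto
    also have "\<dots> = (\<Sum>i=1..s. rvec n X \<omega> i)"
      using s by (intro sum.cong) (auto simp: rvec_def)
    finally show ?thesis .
  qed
  moreover have "rvec n Y \<omega> \<in> space (PiM {1..n} (\<lambda>_. borel))" for Y :: "nat \<Rightarrow> 'a \<Rightarrow> real"
    by (auto simp: rvec_def space_PiM)
  ultimately show ?thesis
    using \<open>t \<le> n\<close> by (auto simp: last_crossing_def)
qed

text \<open>On the event, 1 is at most \<open>a / t\<close> times the sum of
  \<open>\<bar>X i \<omega>\<bar>\<close> over \<open>i \<le> t\<close>. After integration, symmetry
  of the event makes the \<open>t\<close> summands equal.\<close>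

lemma emeasure_last_crossing_le:
  assumes ex: "exchangeable M n X" and t: "t \<in> {1..n}" and a: "0 < a"
  shows "emeasure M {\<omega> \<in> space M. rvec n X \<omega> \<in> last_crossing n (1 / a) t} \<le>
    ennreal a * (\<integral>\<^sup>+\<omega>. ennreal \<bar>X 1 \<omega>\<bar> * indicator (last_crossing n (1 / a) t) (rvec n X \<omega>) \<partial>M)"
proof -
  let ?L = "last_crossing n (1 / a) t"
  let ?P = "PiM {1..n} (\<lambda>_. borel :: real measure)"
  let ?I = "\<lambda>i. \<integral>\<^sup>+\<omega>. ennreal \<bar>X i \<omega>\<bar> * indicator ?L (rvec n X \<omega>) \<partial>M"
  have V [measurable]: "rvec n X \<in> measurable M ?P"
    using exchangeable_rvec_measurable[OF ex permutes_id] by simp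
  have L [measurable]: "?L \<in> sets ?P" using t by (intro sets_last_crossing) auto
  have X [measurable]: "X i \<in> borel_measurable M" if "i \<in> {1..n}" for i
    using ex that by (simp add: exchangeable_def)
  have I: "?I i = ?I 1" if i: "i \<in> {1..t}" for i
  proof -
    \<comment> \<open>Swapping 1 and \<open>i\<close> moves \<open>X i\<close> to coordinate 1. As a
      permutation of \<open>{1..t}\<close> it preserves the event; as one of \<open>{1..n}\<close>
      it is admissible for exchangeability.\<close>
    let ?\<pi> = "Transposition.transpose 1 i"
    have \<pi>t: "?\<pi> permutes {1..t}" using i by (intro permutes_swap_id) auto
    have \<pi>n: "?\<pi> permutes {1..n}" using i t by (intro permutes_swap_id) auto
    let ?g = "\<lambda>x. ennreal \<bar>x 1\<bar> * indicator ?L x"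
    have [measurable]: "(\<lambda>x. x 1) \<in> borel_measurable ?P"
      using t by (intro measurable_component_singleton) auto
    have g: "?g \<in> borel_measurable ?P" by measurable
    have "?I i = (\<integral>\<^sup>+\<omega>. ?g (rvec n (\<lambda>i. X (?\<pi> i)) \<omega>) \<partial>M)"
      using t last_crossing_permute[OF \<pi>t, of n X]
      by (intro nn_integral_cong) (auto simp: rvec_def indicator_def)
    also have "\<dots> = (\<integral>\<^sup>+\<omega>. ?g (rvec n X \<omega>) \<partial>M)"
      by (rule exchangeable_nn_integral[OF ex \<pi>n g])
    also have "\<dots> = ?I 1"
      using t by (intro nn_integral_cong) (auto simp: rvec_def)
    finally show ?thesis .
  qed
  have pt: "indicator ?L (rvec n X \<omega>) \<le>
      ennreal (a / t) * (\<Sum>i=1..t. ennreal \<bar>X i \<omega>\<bar> * indicator ?L (rvec n X \<omega>))" for \<omega>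
  proof (cases "rvec n X \<omega> \<in> ?L")
    case True
    have "(\<Sum>i=1..t. rvec n X \<omega> i) = (\<Sum>i=1..t. X i \<omega>)"
      using t by (intro sum.cong) (auto simp: rvec_def)
    with True have "1 / a \<le> \<bar>1 / real t * (\<Sum>i=1..t. X i \<omega>)\<bar>"
      by (simp add: last_crossing_def)
    also have "\<dots> \<le> 1 / real t * (\<Sum>i=1..t. \<bar>X i \<omega>\<bar>)"
      by (simp add: abs_mult divide_right_mono)
    finally have "1 \<le> a / t * (\<Sum>i=1..t. \<bar>X i \<omega>\<bar>)"
      using a t by (simp add: field_simps)
    then show ?thesis using True a
      by (simp add: ennreal_mult[symmetric] sum_nonneg)
  qed simp
  have "emeasure M {\<omega> \<in> space M. rvec n X \<omega> \<in> ?L} = (\<integral>\<^sup>+\<omega>. indicator ?L (rvec n X \<omega>) \<partial>M)"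
  proof -
    have "emeasure M {\<omega> \<in> space M. rvec n X \<omega> \<in> ?L} =
        (\<integral>\<^sup>+\<omega>. indicator {\<omega> \<in> space M. rvec n X \<omega> \<in> ?L} \<omega> \<partial>M)"
      by (rule nn_integral_indicator[symmetric]) measurable
    then show ?thesis by (simp add: indicator_def cong: nn_integral_cong)
  qed
  also have "\<dots> \<le> (\<integral>\<^sup>+\<omega>. ennreal (a / t) * (\<Sum>i=1..t. ennreal \<bar>X i \<omega>\<bar> * indicator ?L (rvec n X \<omega>)) \<partial>M)"
    by (intro nn_integral_mono pt)
  also have "\<dots> = ennreal (a / t) * (\<Sum>i=1..t. ?I i)"
  proof -
    have m: "(\<lambda>\<omega>. ennreal \<bar>X i \<omega>\<bar> * indicator ?L (rvec n X \<omega>)) \<in> borel_measurable M"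
      if "i \<in> {1..t}" for i
    proof -
      have [measurable]: "X i \<in> borel_measurable M" using X t that by auto
      show ?thesis by measurable
    qed
    have "(\<lambda>\<omega>. \<Sum>i=1..t. ennreal \<bar>X i \<omega>\<bar> * indicator ?L (rvec n X \<omega>)) \<in> borel_measurable M"
      by (intro borel_measurable_sum m)
    then show ?thesis by (simp only: nn_integral_cmult nn_integral_sum[OF m])
  qed
  also have "\<dots> = ennreal (a / t) * (\<Sum>i=1..t. ?I 1)"
    by (intro arg_cong[where f = "(*) (ennreal (a / t))"] sum.cong refl I)
  also have "\<dots> = ennreal (a / t) * (ennreal t * ?I 1)"
    by (simp add: ennreal_of_nat_eq_real_of_nat)
  also have "\<dots> = ennreal a * ?I 1"
    using a t by (simp add: ennreal_mult[symmetric] mult.assoc[symmetric])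
  finally show ?thesis .
qed

section \<open>Union bound over the last crossing time\<close>

theorem theorem5p3:
  fixes M :: "'a measure" and X :: "nat \<Rightarrow> 'a \<Rightarrow> real" and U :: "'a \<Rightarrow> real"
    and n :: nat and a :: real
  assumes "prob_space M"
    and "n \<ge> 1"
    and "exchangeable M n X"
    and "U \<in> borel_measurable M"
    and "distr M borel U = uniform_measure lborel {0..1}"
    and "indep_rvec M U n X"
    and "0 < a" and "a < 1"
  shows "emeasure M {\<omega> \<in> space M. X 1 \<omega> \<ge> U \<omega> / a \<or>
             (\<exists>t\<in>{1..n}. \<bar>1 / real t * (\<Sum>i=1..t. X i \<omega>)\<bar> \<ge> 1 / a)}
         \<le> ennreal a * (\<integral>\<^sup>+\<omega>. ennreal \<bar>X 1 \<omega>\<bar> \<partial>M)"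
proof -
  interpret prob_space M by fact
  let ?P = "PiM {1..n} (\<lambda>_. borel :: real measure)"
  let ?L = "last_crossing n (1 / a)"
  let ?V = "rvec n X"
  define R where "R = space ?P - (\<Union>t\<in>{1..n}. ?L t)"
  \<comment> \<open>Truncating to the vectors without crossing makes \<open>W\<close> agree with
    \<open>X 1\<close> there and vanish elsewhere, so the uniform bound for \<open>W\<close> charges
    only the part of \<open>\<bar>X 1 \<omega>\<bar>\<close> left over by the crossing
    events.\<close>
  define W where "W \<omega> = X 1 \<omega> * indicator R (?V \<omega>)" for \<omega>
  define A where "A t = {\<omega> \<in> space M. ?V \<omega> \<in> ?L t}" for t
  have V [measurable]: "?V \<in> measurable M ?P"
    using exchangeable_rvec_measurable[OF assms(3) permutes_id] by simp
  have [measurable]: "?L t \<in> sets ?P" if "t \<in> {1..n}" for t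
    using that by (intro sets_last_crossing) auto
  have [measurable]: "R \<in> sets ?P" unfolding R_def by measurable
  have [measurable]: "X 1 \<in> borel_measurable M" "U \<in> borel_measurable M"
    using assms by (auto simp: exchangeable_def)
  have W [measurable]: "W \<in> borel_measurable M" unfolding W_def by measurable
  have [measurable]: "A t \<in> sets M" if "t \<in> {1..n}" for t
    unfolding A_def using that by measurable
  have "indep_var borel U borel (\<lambda>\<omega>. (\<lambda>x. x 1 * indicator R x) (?V \<omega>))"
  proof (rule indep_rvec_imp_indep_var[OF _ V])
    have [measurable]: "(\<lambda>x. x 1) \<in> borel_measurable ?P"
      using assms(2) by (intro measurable_component_singleton) auto
    show "(\<lambda>x. x 1 * indicator R x) \<in> borel_measurable ?P" by measurable
  qed (use assms in auto)
  \<comment> \<open>Here \<open>n \<ge> 1\<close> matters: it puts 1 in \<open>{1..n}\<close>, so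
    coordinate 1 of \<open>rvec n X\<close> is \<open>X 1\<close> and not
    \<open>undefined\<close>.\<close>
  also have "(\<lambda>\<omega>. (\<lambda>x. x 1 * indicator R x) (?V \<omega>)) = W"
    using assms(2) by (auto simp: W_def rvec_def)
  finally have indW: "indep_var borel U borel W" .
  \<comment> \<open>An inclusion suffices: a vector outside \<open>R\<close> lies in some
    \<open>?L t\<close>, whereas on \<open>R\<close> only the first alternative can hold, and there
    \<open>W\<close> equals \<open>X 1\<close>.\<close>
  have "{\<omega> \<in> space M. X 1 \<omega> \<ge> U \<omega> / a \<or>
             (\<exists>t\<in>{1..n}. \<bar>1 / real t * (\<Sum>i=1..t. X i \<omega>)\<bar> \<ge> 1 / a)}
      \<subseteq> (\<Union>t\<in>{1..n}. A t) \<union> {\<omega> \<in> space M. U \<omega> \<le> a * W \<omega>}" (is "?E \<subseteq> _")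
  proof
    fix \<omega> assume \<omega>: "\<omega> \<in> ?E"
    then have sp: "?V \<omega> \<in> space ?P" using measurable_space[OF V] by auto
    have sums: "(\<Sum>i=1..t. ?V \<omega> i) = (\<Sum>i=1..t. X i \<omega>)" if "t \<le> n" for t
      using that by (intro sum.cong) (auto simp: rvec_def)
    show "\<omega> \<in> (\<Union>t\<in>{1..n}. A t) \<union> {\<omega> \<in> space M. U \<omega> \<le> a * W \<omega>}"
    proof (cases "?V \<omega> \<in> R")
      case True
      then have "\<not> 1 / a \<le> \<bar>1 / real t * (\<Sum>i=1..t. X i \<omega>)\<bar>" if "t \<in> {1..n}" for t
        using last_crossing_exists[OF sp that, of "1 / a"] that sums[of t] by (auto simp: R_def)
      then have "U \<omega> / a \<le> X 1 \<omega>" using \<omega> by blast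
      then show ?thesis using True \<omega> assms(7) by (auto simp: W_def field_simps)
    next
      case False
      then show ?thesis using \<omega> sp by (auto simp: R_def A_def)
    qed
  qed
  then have "emeasure M ?E \<le> emeasure M ((\<Union>t\<in>{1..n}. A t) \<union> {\<omega> \<in> space M. U \<omega> \<le> a * W \<omega>})"
    by (intro emeasure_mono) measurable
  also have "\<dots> \<le> emeasure M (\<Union>t\<in>{1..n}. A t) + emeasure M {\<omega> \<in> space M. U \<omega> \<le> a * W \<omega>}"
    by (intro emeasure_subadditive) measurable
  also have "\<dots> \<le> (\<Sum>t=1..n. emeasure M (A t)) + emeasure M {\<omega> \<in> space M. U \<omega> \<le> a * W \<omega>}"
    by (intro add_right_mono emeasure_subadditive_finite) auto
  also have "\<dots> \<le> (\<Sum>t=1..n. ennreal a * (\<integral>\<^sup>+\<omega>. ennreal \<bar>X 1 \<omega>\<bar> * indicator (?L t) (?V \<omega>) \<partial>M)) +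
      ennreal a * (\<integral>\<^sup>+\<omega>. ennreal \<bar>W \<omega>\<bar> \<partial>M)"
    unfolding A_def using assms indW
    by (intro add_mono sum_mono emeasure_last_crossing_le indep_var_uniform_le) auto
  also have "\<dots> = ennreal a * (\<integral>\<^sup>+\<omega>. (\<Sum>t=1..n. ennreal \<bar>X 1 \<omega>\<bar> * indicator (?L t) (?V \<omega>)) +
      ennreal \<bar>W \<omega>\<bar> \<partial>M)"
  proof -
    have m: "(\<lambda>\<omega>. ennreal \<bar>X 1 \<omega>\<bar> * indicator (?L t) (?V \<omega>)) \<in> borel_measurable M"
      if "t \<in> {1..n}" for t
      using that by measurable
    then have "(\<lambda>\<omega>. \<Sum>t=1..n. ennreal \<bar>X 1 \<omega>\<bar> * indicator (?L t) (?V \<omega>)) \<in> borel_measurable M"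
      by (rule borel_measurable_sum)
    moreover have "(\<lambda>\<omega>. ennreal \<bar>W \<omega>\<bar>) \<in> borel_measurable M" by measurable
    ultimately show ?thesis
      by (simp only: nn_integral_add nn_integral_sum[OF m] sum_distrib_left distrib_left)
  qed
  \<comment> \<open>The sets \<open>?L t\<close> are disjoint and \<open>R\<close> is the complement
    of their union, so the indicators add up to 1 and the pieces of
    \<open>\<bar>X 1 \<omega>\<bar>\<close> recombine without loss.\<close>
  also have "\<dots> = ennreal a * (\<integral>\<^sup>+\<omega>. ennreal \<bar>X 1 \<omega>\<bar> \<partial>M)"
  proof (intro arg_cong[where f = "(*) (ennreal a)"] nn_integral_cong)
    fix \<omega> assume "\<omega> \<in> space M"
    then have sp: "?V \<omega> \<in> space ?P" using measurable_space[OF V] by auto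
    have "(\<Sum>t=1..n. ennreal \<bar>X 1 \<omega>\<bar> * indicator (?L t) (?V \<omega>)) =
        ennreal \<bar>X 1 \<omega>\<bar> * indicator (\<Union>t\<in>{1..n}. ?L t) (?V \<omega>)"
      by (simp only: sum_distrib_left[symmetric] indicator_UN_disjoint[OF finite_atLeastAtMost disjoint_family_last_crossing])
    with sp show "(\<Sum>t=1..n. ennreal \<bar>X 1 \<omega>\<bar> * indicator (?L t) (?V \<omega>)) + ennreal \<bar>W \<omega>\<bar> =
        ennreal \<bar>X 1 \<omega>\<bar>"
      by (auto simp: W_def R_def indicator_def)
  qed
  finally show ?thesis .
qed

end
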